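(* Let $\mathbf A\in\mathbb R^{m\times n}$ be nonzero with rank $r$ and let $\mathbf b\in\mathbb R^m$ (the linear system $\mathbf A\mathbf x=\mathbf b$ may be consistent or inconsistent). Let $\alpha>0$ and let $\mathbf x^k$ be the $k$th iterate of the REBK algorithm (defined in the context) with $\mathbf z^0\in\mathbb R^m$ and $\mathbf x^0\in\mathrm{ran}(\mathbf A^{T})$. Then for every $k\ge 0$, $$\big\|\mathbb E[\mathbf x^k-\mathbf A^\dagger\mathbf b]\big\|_2\le\delta^k\left(\|\mathbf x^0-\mathbf A^\dagger\mathbf b\|_2+\frac{\alpha k\|\mathbf A^{T}\mathbf z^0\|_2}{\|\mathbf A\|_F^2}\right),$$ where $$\delta:=\max_{1\le i\le r}\left|1-\frac{\alpha\sigma_i^2(\mathbf A)}{\|\mathbf A\|_F^2}\right|.$$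
   Context: Notation: $[m]=\{1,\dots,m\}$. $\mathbf A^\dagger$ is the Moore-Penrose pseudoinverse, $\mathrm{ran}(\cdot)$ the column space, $\|\cdot\|_F$ the Frobenius norm, $\|\cdot\|_2$ the Euclidean norm. $\sigma_1(\mathbf A)\ge\dots\ge\sigma_r(\mathbf A)>0$ are the nonzero singular values of $\mathbf A$, $r=\mathrm{rank}(\mathbf A)$. For index sets $\mathcal I\subseteq[m]$, $\mathcal J\subseteq[n]$, $\mathbf A_{\mathcal I,:}$ and $\mathbf A_{:,\mathcal J}$ are the row submatrix indexed by $\mathcal I$ and the column submatrix indexed by $\mathcal J$; $\mathbf b_{\mathcal I}$, $\mathbf z_{\mathcal I}$ are the corresponding subvectors. REBK algorithm (randomized extended block Kaczmarz): Let $\{\mathcal I_1,\dots,\mathcal I_s\}$ and $\{\mathcal J_1,\dots,\mathcal J_t\}$ be partitions of $[m]$ and $[n]$ respectively (pairwise disjoint sets with the given union), and let $\alpha>0$. Given deterministic initial vectors $\mathbf z^0\in\mathbb R^m$, $\mathbf x^0\in\mathbb R^n$, for $k=1,2,\dots$: (1) pick $j\in[t]$ with probability $\|\mathbf A_{:,\mathcal J_j}\|_F^2/\|\mathbf A\|_F^2$ and set $\mathbf z^k=\mathbf z^{k-1}-\frac{\alpha}{\|\mathbf A_{:,\mathcal J_j}\|_F^2}\mathbf A_{:,\mathcal J_j}(\mathbf A_{:,\mathcal J_j})^{T}\mathbf z^{k-1}$; (2) pick $i\in[s]$ with probability $\|\mathbf A_{\mathcal I_i,:}\|_F^2/\|\mathbf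 A\|_F^2$ and set $\mathbf x^k=\mathbf x^{k-1}-\frac{\alpha}{\|\mathbf A_{\mathcal I_i,:}\|_F^2}(\mathbf A_{\mathcal I_i,:})^{T}(\mathbf A_{\mathcal I_i,:}\mathbf x^{k-1}-\mathbf b_{\mathcal I_i}+\mathbf z^k_{\mathcal I_i})$. (A zero block is picked with probability zero.) All random picks (over all iterations, rows and columns) are mutually independent. $\mathbb E$ is expectation with respect to these picks. *)

theory Defs
  imports "HOL-Probability.Probability"
begin

definition frobenius_norm :: "real^'n^'m \<Rightarrow> real" where
  "frobenius_norm A = sqrt (\<Sum>i\<in>UNIV. \<Sum>j\<in>UNIV. (A $ i $ j)\<^sup>2)"

lemma frobenius_norm_eq_norm: "frobenius_norm A = norm A"
  by (simp add: frobenius_norm_def norm_vec_def L2_set_def sum_nonneg)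

definition is_pseudoinverse :: "real^'n^'m \<Rightarrow> real^'m^'n \<Rightarrow> bool" where
  "is_pseudoinverse A X \<longleftrightarrow>
     A ** X ** A = A \<and> X ** A ** X = X \<and>
     transpose (A ** X) = A ** X \<and> transpose (X ** A) = X ** A"

lemma is_pseudoinverse_unique:
  assumes "is_pseudoinverse A X" "is_pseudoinverse A Y"
  shows "X = Y"
proof -
  have X: "A ** X ** A = A" "X ** A ** X = X" "transpose (A ** X) = A ** X" "transpose (X ** A) = X ** A"
    and Y: "A ** Y ** A = A" "Y ** A ** Y = Y" "transpose (A ** Y) = A ** Y" "transpose (Y ** A) = Y ** A"
    using assms by (auto simp: is_pseudoinverse_def)
  have AX: "A ** X = A ** Y"
  proof -
    have "A ** X = transpose (A ** Y ** (A ** X))"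
      using X(3) Y(3) Y(1) by (simp add: matrix_mul_assoc)
    also have "\<dots> = A ** X ** (A ** Y)"
      by (simp only: matrix_transpose_mul[of "A ** Y" "A ** X"] X(3) Y(3))
    also have "\<dots> = A ** Y" using X(1) by (simp add: matrix_mul_assoc)
    finally show ?thesis .
  qed
  have XA: "X ** A = Y ** A"
  proof -
    have "X ** A = transpose (X ** A ** (Y ** A))"
      using X(4) Y(1) by (metis matrix_mul_assoc)
    also have "\<dots> = Y ** A ** (X ** A)"
      by (simp only: matrix_transpose_mul[of "X ** A" "Y ** A"] X(4) Y(4))
    also have "\<dots> = Y ** A" using X(1) by (metis matrix_mul_assoc)
    finally show ?thesis .
  qed
  show ?thesis by (metis AX XA X(2) Y(2) matrix_mul_assoc)
qed

definition pseudoinverse :: "real^'n^'m \<Rightarrow> real^'m^'n" where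
  "pseudoinverse A = (THE X. is_pseudoinverse A X)"

definition col_space :: "real^'n^'m \<Rightarrow> (real^'m) set" where
  "col_space A = range (\<lambda>x. A *v x)"

definition singular_space :: "real^'n^'m \<Rightarrow> real \<Rightarrow> (real^'n) set" where
  "singular_space A \<sigma> = {v. (transpose A ** A) *v v = \<sigma>\<^sup>2 *\<^sub>R v}"

text \<open>
  Positive square roots of the eigenvalues of the Gram matrix \<open>A\<^sup>T A\<close>, in decreasing order,
  each repeated according to its multiplicity (algebraic and geometric multiplicities agree, as
  the Gram matrix is symmetric).
\<close>

definition nonzero_singular_values :: "real^'n^'m \<Rightarrow> real list" where
  "nonzero_singular_values A =
     concat (map (\<lambda>\<sigma>. replicate (dim (singular_space A \<sigma>)) \<sigma>)
       (rev (sorted_list_of_set {\<sigma>. 0 < \<sigma> \<and> (\<exists>v\<in>singular_space A \<sigma>. v \<noteq> 0)})))"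

definition singular_value :: "nat \<Rightarrow> real^'n^'m \<Rightarrow> real" where
  "singular_value i A = nonzero_singular_values A ! (i - 1)"

definition rebk_rate :: "real^'n^'m \<Rightarrow> real \<Rightarrow> real" where
  "rebk_rate A \<alpha> =
     Max ((\<lambda>i. \<bar>1 - \<alpha> * (singular_value i A)\<^sup>2 / (frobenius_norm A)\<^sup>2\<bar>) ` {1..rank A})"

text \<open>
  The dimensions are types, so submatrices and subvectors are padded with zeros outside the
  selected indices. This changes neither the Frobenius norms nor the products taken below.
\<close>

definition row_block :: "real^'n^'m \<Rightarrow> 'm set \<Rightarrow> real^'n^'m" where
  "row_block A I = (\<chi> i j. if i \<in> I then A $ i $ j else 0)"

definition col_block :: "real^'n^'m \<Rightarrow> 'n set \<Rightarrow> real^'n^'m" where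
  "col_block A J = (\<chi> i j. if j \<in> J then A $ i $ j else 0)"

definition subvec :: "real^'m \<Rightarrow> 'm set \<Rightarrow> real^'m" where
  "subvec b I = (\<chi> i. if i \<in> I then b $ i else 0)"

definition block_partition :: "(nat \<Rightarrow> 'a set) \<Rightarrow> nat \<Rightarrow> bool" where
  "block_partition P s \<longleftrightarrow> disjoint_family_on P {1..s} \<and> (\<Union>i\<in>{1..s}. P i) = UNIV"

definition rebk_z_step :: "real^'n^'m \<Rightarrow> real \<Rightarrow> 'n set \<Rightarrow> real^'m \<Rightarrow> real^'m" where
  "rebk_z_step A \<alpha> J z =
     z - (\<alpha> / (frobenius_norm (col_block A J))\<^sup>2) *\<^sub>R
           (col_block A J *v (transpose (col_block A J) *v z))"

definition rebk_x_step ::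
  "real^'n^'m \<Rightarrow> real^'m \<Rightarrow> real \<Rightarrow> 'm set \<Rightarrow> real^'m \<Rightarrow> real^'n \<Rightarrow> real^'n" where
  "rebk_x_step A b \<alpha> I z x =
     x - (\<alpha> / (frobenius_norm (row_block A I))\<^sup>2) *\<^sub>R
           (transpose (row_block A I) *v (row_block A I *v x - subvec b I + subvec z I))"

text \<open>
  The iterates for fixed sequences \<open>jp\<close>, \<open>ip\<close> of picked block indices; the picks of iteration
  \<open>k \<ge> 1\<close> are \<open>jp k\<close> and \<open>ip k\<close>, and the values at \<open>0\<close> are not used.
\<close>

primrec rebk_z ::
  "real^'n^'m \<Rightarrow> real \<Rightarrow> (nat \<Rightarrow> 'n set) \<Rightarrow> real^'m \<Rightarrow> (nat \<Rightarrow> nat) \<Rightarrow> nat \<Rightarrow> real^'m" where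
  "rebk_z A \<alpha> J z0 jp 0 = z0"
| "rebk_z A \<alpha> J z0 jp (Suc k) = rebk_z_step A \<alpha> (J (jp (Suc k))) (rebk_z A \<alpha> J z0 jp k)"

primrec rebk_x ::
  "real^'n^'m \<Rightarrow> real^'m \<Rightarrow> real \<Rightarrow> (nat \<Rightarrow> 'm set) \<Rightarrow> (nat \<Rightarrow> 'n set) \<Rightarrow>
   real^'m \<Rightarrow> real^'n \<Rightarrow> (nat \<Rightarrow> nat) \<Rightarrow> (nat \<Rightarrow> nat) \<Rightarrow> nat \<Rightarrow> real^'n" where
  "rebk_x A b \<alpha> I J z0 x0 jp ip 0 = x0"
| "rebk_x A b \<alpha> I J z0 x0 jp ip (Suc k) =
     rebk_x_step A b \<alpha> (I (ip (Suc k))) (rebk_z A \<alpha> J z0 jp (Suc k))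
       (rebk_x A b \<alpha> I J z0 x0 jp ip k)"

definition rebk_picks ::
  "'w measure \<Rightarrow> real^'n^'m \<Rightarrow> (nat \<Rightarrow> 'm set) \<Rightarrow> nat \<Rightarrow> (nat \<Rightarrow> 'n set) \<Rightarrow> nat \<Rightarrow>
   (nat \<Rightarrow> 'w \<Rightarrow> nat) \<Rightarrow> (nat \<Rightarrow> 'w \<Rightarrow> nat) \<Rightarrow> bool" where
  "rebk_picks M A I s J t jp ip \<longleftrightarrow>
     prob_space M \<and>
     prob_space.indep_vars M (\<lambda>_. count_space UNIV) (case_sum jp ip) ({1..} <+> {1..}) \<and>
     (\<forall>k\<ge>1. \<forall>\<omega>\<in>space M. jp k \<omega> \<in> {1..t} \<and> ip k \<omega> \<in> {1..s}) \<and>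
     (\<forall>k\<ge>1. \<forall>j\<in>{1..t}. measure M {\<omega> \<in> space M. jp k \<omega> = j} =
        (frobenius_norm (col_block A (J j)))\<^sup>2 / (frobenius_norm A)\<^sup>2) \<and>
     (\<forall>k\<ge>1. \<forall>i\<in>{1..s}. measure M {\<omega> \<in> space M. ip k \<omega> = i} =
        (frobenius_norm (row_block A (I i)))\<^sup>2 / (frobenius_norm A)\<^sup>2)"

end

theory Submission
  imports Defs
begin

text \<open>
  Write \<open>c = \<alpha> / \<parallel>A\<parallel>\<^sub>F\<^sup>2\<close> and \<open>G = I - c A\<^sup>T A\<close>. The probability of a block is proportional to the
  square of its Frobenius norm, by which its step size is divided. Averaging one step over its pick therefore gives
  a full gradient step (\<open>mean_row_block_step\<close>). Each pick is independent of the past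
  and the steps are affine, so the expectation may be taken step by step
  (\<open>expectation_random_affine_map\<close>): the means of the iterates follow the deterministic recursion

  \<open>E z\<^sup>k = (I - c A A\<^sup>T) (E z\<^sup>k\<^sup>-\<^sup>1)\<close> and \<open>E x\<^sup>k = E x\<^sup>k\<^sup>-\<^sup>1 - c A\<^sup>T (A (E x\<^sup>k\<^sup>-\<^sup>1) - b + E z\<^sup>k)\<close>.

  Because \<open>A\<^sup>T b = A\<^sup>T A A\<^sup>\<dagger> b\<close> and \<open>A\<^sup>T (I - c A A\<^sup>T) = G A\<^sup>T\<close>, the mean error solves in closed form as
  \<open>E x\<^sup>k - A\<^sup>\<dagger> b = G\<^sup>k (x\<^sup>0 - A\<^sup>\<dagger> b) - c k G\<^sup>k (A\<^sup>T z\<^sup>0)\<close> (\<open>rebk_error_expectation\<close>).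

  Both \<open>x\<^sup>0 - A\<^sup>\<dagger> b\<close> and \<open>A\<^sup>T z\<^sup>0\<close> lie in the row space of \<open>A\<close>, which \<open>G\<close> maps to itself and on which \<open>G\<close>
  shrinks norms by the factor \<open>\<delta>\<close> (\<open>norm_gradient_step_le\<close>): the norm of the symmetric map \<open>G\<close> on
  the row space is the modulus of one of its eigenvalues there, and these are the numbers
  \<open>1 - c \<sigma>\<^sup>2\<close> with \<open>\<sigma>\<close> a nonzero singular value of \<open>A\<close>. The triangle inequality gives the bound.
\<close>

section \<open>The Moore-Penrose pseudoinverse\<close>
lemma inner_matrix_transpose:
  fixes A :: "real^'n^'m"
  shows "(A *v x) \<bullet> y = x \<bullet> (transpose A *v y)"
  by (metis dot_lmul_matrix transpose_transpose vector_transpose_matrix)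

text \<open>
  The normal equation determines \<open>A y\<close>, since \<open>\<parallel>A y\<parallel>\<^sup>2 = y \<bullet> A\<^sup>T A y\<close>.
\<close>
lemma gram_kernel:
  fixes A :: "real^'n^'m"
  assumes "transpose A *v (A *v y) = 0"
  shows "A *v y = 0"
proof -
  have "(A *v y) \<bullet> (A *v y) = 0"
    by (simp only: inner_matrix_transpose assms inner_zero_right)
  then show ?thesis by simp
qed

lemma generalized_inverse_exists:
  fixes N :: "real^'n^'m"
  shows "\<exists>H :: real^'m^'n. N ** H ** N = N"
proof -
  obtain g :: "real^'m \<Rightarrow> real^'n" where g: "linear g" "\<And>x. N *v g (N *v x) = N *v x"
    using real_vector.linear_exists_right_inverse_on[OF matrix_vector_mul_linear[of N] subspace_UNIV]
    by auto
  have "N ** matrix g ** N = N"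
    by (simp add: matrix_eq matrix_vector_mul_assoc[symmetric] matrix_works[OF g(1)[unfolded linear_matrix_vector_mul_eq[symmetric]]] g(2))
  then show ?thesis by blast
qed

text \<open>
  The matrix \<open>P = A H A\<^sup>T\<close>, with \<open>H\<close> a generalized inverse of the Gram matrix, is the orthogonal
  projector onto the column space of \<open>A\<close>. It fixes \<open>A\<close> because \<open>(H A\<^sup>T A - 1) x\<close> always lies in
  the kernel of the Gram matrix, hence of \<open>A\<close>. It is symmetric because \<open>P A = A\<close> gives
  \<open>P P\<^sup>T = P\<close>.
\<close>
lemma range_projector_exists:
  fixes A :: "real^'n^'m"
  shows "\<exists>H :: real^'n^'n. A ** H ** transpose A ** A = A \<and>
           transpose (A ** H ** transpose A) = A ** H ** transpose A"
proof -
  obtain H :: "real^'n^'n"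
    where H: "(transpose A ** A) ** H ** (transpose A ** A) = transpose A ** A"
    using generalized_inverse_exists by blast
  have PA: "A ** H ** transpose A ** A = A"
  proof (subst matrix_eq, rule allI)
    fix x
    let ?y = "H *v (transpose A *v (A *v x)) - x"
    have "transpose A *v (A *v ?y) = ((transpose A ** A) ** H ** (transpose A ** A)) *v x
            - (transpose A ** A) *v x"
      by (simp only: matrix_vector_mult_diff_distrib matrix_vector_mul_assoc matrix_mul_assoc)
    then have "A *v ?y = 0"
      using H gram_kernel by auto
    then show "(A ** H ** transpose A ** A) *v x = A *v x"
      by (simp only: matrix_vector_mult_diff_distrib matrix_vector_mul_assoc[symmetric]
          right_minus_eq)
  qed
  let ?P = "A ** H ** transpose A"
  have "transpose A ** transpose ?P = transpose A"
    by (metis PA matrix_transpose_mul)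
  then have "?P ** transpose ?P = ?P"
    by (metis matrix_mul_assoc)
  then have "transpose ?P = ?P"
    by (metis matrix_transpose_mul transpose_transpose)
  with PA show ?thesis by blast
qed

text \<open>
  Existence of the pseudoinverse. With \<open>P = A H A\<^sup>T\<close> and \<open>Q = A\<^sup>T K A\<close> the orthogonal projectors
  onto the column space and the row space, \<open>X = A\<^sup>T K P\<close> satisfies \<open>A X = P\<close> and \<open>X A = Q\<close>, from
  which the four Penrose equations follow.
\<close>
lemma pseudoinverse_is_pseudoinverse: "is_pseudoinverse A (pseudoinverse A)"
proof -
  obtain H where H: "A ** H ** transpose A ** A = A"
      "transpose (A ** H ** transpose A) = A ** H ** transpose A"
    using range_projector_exists by blast
  obtain K where K: "transpose A ** K ** A ** transpose A = transpose A"
      "transpose (transpose A ** K ** A) = transpose A ** K ** A"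
    using range_projector_exists[of "transpose A"] by auto
  let ?P = "A ** H ** transpose A" and ?Q = "transpose A ** K ** A"
  have AQ: "A ** ?Q = A"
    by (metis K matrix_transpose_mul transpose_transpose)
  let ?X = "transpose A ** K ** ?P"
  have AX: "A ** ?X = ?P"
    using AQ by (metis matrix_mul_assoc)
  have XA: "?X ** A = ?Q"
    using H(1) by (metis matrix_mul_assoc)
  have XAX: "?X ** A ** ?X = ?X"
    using XA K(1) by (metis matrix_mul_assoc)
  have "is_pseudoinverse A ?X"
    unfolding is_pseudoinverse_def using AX XA XAX H K by simp
  then show ?thesis
    unfolding pseudoinverse_def by (metis is_pseudoinverse_unique theI)
qed

text \<open>
  The two facts about \<open>A\<^sup>\<dagger> b\<close> that the convergence proof uses: it solves the least-squares problem,
  and it lies in the row space, so that the initial error does too whenever \<open>x\<^sup>0\<close> does.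
\<close>
lemma pseudoinverse_normal_equation:
  "transpose A *v (A *v (pseudoinverse A *v b)) = transpose A *v b"
proof -
  have "transpose A ** transpose (A ** pseudoinverse A) = transpose A"
    using pseudoinverse_is_pseudoinverse[of A]
    by (metis is_pseudoinverse_def matrix_transpose_mul)
  then show ?thesis
    using pseudoinverse_is_pseudoinverse[of A]
    by (simp only: is_pseudoinverse_def matrix_vector_mul_assoc)
qed

lemma pseudoinverse_in_row_space: "pseudoinverse A *v b \<in> col_space (transpose A)"
proof -
  let ?X = "pseudoinverse A"
  have "?X = transpose (?X ** A) ** ?X"
    using pseudoinverse_is_pseudoinverse[of A] by (simp add: is_pseudoinverse_def)
  also have "\<dots> = transpose A ** (transpose ?X ** ?X)"
    by (simp only: matrix_transpose_mul matrix_mul_assoc)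
  finally have "?X *v b = transpose A *v ((transpose ?X ** ?X) *v b)"
    by (metis matrix_vector_mul_assoc)
  then show ?thesis by (auto simp: col_space_def)
qed

lemma subspace_col_space: "subspace (col_space A)"
  unfolding col_space_def
  by (rule linear_subspace_image) (auto simp: subspace_UNIV)

section \<open>Contraction on the row space\<close>

text \<open>
  The only piece of the spectral theorem that is needed: the norm \<open>\<rho>\<close> of a symmetric map on an
  invariant subspace is the modulus of an eigenvalue. A unit vector \<open>v\<close> that maximizes
  \<open>\<parallel>G v\<parallel>\<close> satisfies \<open>G (G v) = \<rho>\<^sup>2 v\<close>; since \<open>(G - \<rho>) (G + \<rho>) v = 0\<close>, either \<open>v\<close> is an
  eigenvector for \<open>- \<rho>\<close> or \<open>(G + \<rho>) v\<close> is one for \<open>\<rho>\<close>.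
\<close>
lemma symmetric_norm_attained_at_eigenvector:
  fixes G :: "'a::euclidean_space \<Rightarrow> 'a"
  assumes lin: "linear G" and W: "subspace W" "W \<noteq> {0}" and inv: "G ` W \<subseteq> W"
    and sym: "\<And>x y. G x \<bullet> y = x \<bullet> G y"
  obtains u c where "u \<in> W" "u \<noteq> 0" "G u = c *\<^sub>R u" "\<And>w. w \<in> W \<Longrightarrow> norm (G w) \<le> \<bar>c\<bar> * norm w"
proof -
  interpret G: linear G by (rule lin)
  let ?S = "W \<inter> sphere 0 1"
  have unit: "(1 / norm w) *\<^sub>R w \<in> ?S" if "w \<in> W" "w \<noteq> 0" for w
    using that W by (auto intro: subspace_scale)
  have "?S \<noteq> {}"
    using W unit subspace_0[OF W(1)] by blast
  moreover have "compact ?S"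
    using W by (simp add: closed_Int_compact closed_subspace)
  moreover have "continuous_on ?S (\<lambda>w. norm (G w))"
    using lin by (intro continuous_intros linear_continuous_on) (simp add: linear_conv_bounded_linear)
  ultimately obtain v where v: "v \<in> W" "norm v = 1" and max: "\<And>w. w \<in> ?S \<Longrightarrow> norm (G w) \<le> norm (G v)"
    by (metis (lifting) IntD1 IntD2 continuous_attains_sup mem_sphere_0)
  define \<rho> where "\<rho> = norm (G v)"
  have bound: "norm (G w) \<le> \<rho> * norm w" if "w \<in> W" for w
  proof (cases "w = 0")
    case False
    then show ?thesis
      using max[OF unit[OF that False]] by (simp add: G.scale \<rho>_def field_simps)
  qed (simp add: G.zero)
  \<comment> \<open>Expanding \<open>\<parallel>G (G v) - \<rho>\<^sup>2 v\<parallel>\<^sup>2\<close> shows that it is at most \<open>\<rho>\<^sup>4 - 2 \<rho>\<^sup>4 + \<rho>\<^sup>4 = 0\<close>.\<close>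
  have "norm (G (G v)) \<le> \<rho> * \<rho>"
    using bound[of "G v"] inv v(1) unfolding \<rho>_def by blast
  then have "(norm (G (G v)))\<^sup>2 \<le> (\<rho>\<^sup>2)\<^sup>2"
    by (simp add: power2_eq_square mult_mono)
  moreover have "G (G v) \<bullet> v = \<rho>\<^sup>2"
    by (simp add: sym \<rho>_def power2_norm_eq_inner)
  moreover have "(norm (G (G v) - \<rho>\<^sup>2 *\<^sub>R v))\<^sup>2
      = (norm (G (G v)))\<^sup>2 - 2 * \<rho>\<^sup>2 * (G (G v) \<bullet> v) + (\<rho>\<^sup>2)\<^sup>2 * (norm v)\<^sup>2"
    by (simp only: power2_norm_eq_inner inner_diff inner_scaleR_left inner_scaleR_right)
       (simp add: inner_commute power2_eq_square algebra_simps)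
  ultimately have "(norm (G (G v) - \<rho>\<^sup>2 *\<^sub>R v))\<^sup>2 \<le> 0"
    using v(2) by (simp add: power2_eq_square)
  then have sq: "G (G v) = \<rho>\<^sup>2 *\<^sub>R v"
    by simp
  show thesis
  proof (cases "G v = - \<rho> *\<^sub>R v")
    case True
    then show thesis
      using that[of v "- \<rho>"] v bound by (force simp: \<rho>_def)
  next
    case False
    let ?u = "G v + \<rho> *\<^sub>R v"
    have "?u \<in> W"
      using v(1) inv W(1) by (intro subspace_add subspace_scale) auto
    moreover have "?u \<noteq> 0"
      using False by (simp add: add_eq_0_iff2)
    moreover have "G ?u = \<rho> *\<^sub>R ?u"
      by (simp add: G.add G.scale sq algebra_simps power2_eq_square)
    moreover have "\<bar>\<rho>\<bar> = \<rho>"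
      by (simp add: \<rho>_def)
    ultimately show thesis
      using that[of ?u \<rho>] bound by simp
  qed
qed

lemma singular_space_iff:
  "v \<in> singular_space A \<sigma> \<longleftrightarrow> transpose A *v (A *v v) = \<sigma>\<^sup>2 *\<^sub>R v"
  by (simp only: singular_space_def mem_Collect_eq matrix_vector_mul_assoc)

lemma subspace_singular_space: "subspace (singular_space A \<sigma>)"
proof (rule subspaceI)
  show "0 \<in> singular_space A \<sigma>"
    by (simp add: singular_space_def)
  show "x + y \<in> singular_space A \<sigma>" if "x \<in> singular_space A \<sigma>" "y \<in> singular_space A \<sigma>" for x y
    using that by (simp add: singular_space_def matrix_vector_mult_add_rdistrib scaleR_add_right
        matrix_vector_right_distrib)
  show "c *\<^sub>R x \<in> singular_space A \<sigma>" if "x \<in> singular_space A \<sigma>" for c x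
    using that by (simp add: singular_space_def matrix_vector_mult_scaleR)
qed

lemma singular_space_orthogonal:
  assumes "v \<in> singular_space A \<sigma>" "w \<in> singular_space A \<tau>" "0 < \<sigma>" "0 < \<tau>" "\<sigma> \<noteq> \<tau>"
  shows "orthogonal v w"
proof -
  have "\<sigma>\<^sup>2 * (v \<bullet> w) = (transpose A *v (A *v v)) \<bullet> w"
    using assms(1) unfolding singular_space_iff by simp
  also have "\<dots> = v \<bullet> (transpose A *v (A *v w))"
    by (metis inner_matrix_transpose inner_commute)
  also have "\<dots> = \<tau>\<^sup>2 * (v \<bullet> w)"
    using assms(2) unfolding singular_space_iff by simp
  finally have "v \<bullet> w = 0"
    using assms(3-5) by (simp add: power2_eq_iff_nonneg)
  then show ?thesis by (simp add: orthogonal_def)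
qed

lemma singular_space_subset_row_space:
  assumes "0 < \<sigma>"
  shows "singular_space A \<sigma> \<subseteq> col_space (transpose A)"
proof
  fix v assume "v \<in> singular_space A \<sigma>"
  then have "v = transpose A *v ((1 / \<sigma>\<^sup>2) *\<^sub>R (A *v v))"
    using assms unfolding singular_space_iff matrix_vector_mult_scaleR by simp
  then show "v \<in> col_space (transpose A)"
    unfolding col_space_def by blast
qed

text \<open>
  Orthonormal bases of the spaces \<open>singular_space A \<sigma>\<close> for different \<open>\<sigma> > 0\<close> together form an
  orthogonal, hence independent, set in the row space, whose dimension is the rank.
\<close>
lemma sum_dim_singular_space_le_rank:
  assumes T: "finite T" "T \<subseteq> {0<..}"
  shows "(\<Sum>\<sigma>\<in>T. dim (singular_space A \<sigma>)) \<le> rank A"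
proof -
  have "\<exists>B. B \<subseteq> singular_space A \<sigma> \<and> pairwise orthogonal B \<and> 0 \<notin> B \<and> finite B \<and>
          card B = dim (singular_space A \<sigma>)" for \<sigma>
    by (rule orthonormal_basis_subspace[OF subspace_singular_space[of A \<sigma>]])
       (metis finiteI_independent norm_zero zero_neq_one)
  then obtain B where B: "\<And>\<sigma>. B \<sigma> \<subseteq> singular_space A \<sigma>" "\<And>\<sigma>. pairwise orthogonal (B \<sigma>)"
      "\<And>\<sigma>. 0 \<notin> B \<sigma>" "\<And>\<sigma>. finite (B \<sigma>)" "\<And>\<sigma>. card (B \<sigma>) = dim (singular_space A \<sigma>)"
    by metis
  have orth: "orthogonal v w" if "v \<in> B \<sigma>" "w \<in> B \<tau>" "\<sigma> \<in> T" "\<tau> \<in> T" "\<sigma> \<noteq> \<tau>" for v w \<sigma> \<tau>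
    using that T B(1) by (intro singular_space_orthogonal[of v A \<sigma> w \<tau>]) auto
  have "pairwise orthogonal (\<Union>\<sigma>\<in>T. B \<sigma>)"
    using B(2) orth by (auto simp: pairwise_def) metis
  then have ind: "independent (\<Union>\<sigma>\<in>T. B \<sigma>)"
    using B(3) by (intro pairwise_orthogonal_independent) auto
  have "B \<sigma> \<inter> B \<tau> = {}" if "\<sigma> \<in> T" "\<tau> \<in> T" "\<sigma> \<noteq> \<tau>" for \<sigma> \<tau>
    using orth[OF _ _ that] B(3) by (metis disjoint_iff orthogonal_self)
  then have "(\<Sum>\<sigma>\<in>T. dim (singular_space A \<sigma>)) = card (\<Union>\<sigma>\<in>T. B \<sigma>)"
    using B(4,5) T(1) by (subst card_UN_disjoint) auto
  also have "\<dots> \<le> dim (col_space (transpose A))"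
    using B(1) T(2) singular_space_subset_row_space
    by (intro independent_card_le_dim ind) (force simp: subset_iff)
  also have "\<dots> = rank A"
    unfolding col_space_def by (metis rank_dim_range rank_transpose)
  finally show ?thesis .
qed

lemma dim_singular_space_pos:
  assumes "v \<in> singular_space A \<sigma>" "v \<noteq> 0"
  shows "dim (singular_space A \<sigma>) > 0"
proof (rule ccontr)
  assume "\<not> ?thesis"
  then have "singular_space A \<sigma> \<subseteq> {0}" by (simp add: dim_eq_0)
  with assms show False by blast
qed

text \<open>
  Finiteness matters because \<open>sorted_list_of_set\<close> returns a default value for an infinite set.
\<close>
lemma finite_singular_values: "finite {\<sigma>. 0 < \<sigma> \<and> (\<exists>v\<in>singular_space A \<sigma>. v \<noteq> 0)}" (is "finite ?S")
proof (rule ccontr)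
  assume "infinite ?S"
  then obtain T where T: "finite T" "card T = Suc (rank A)" "T \<subseteq> ?S"
    using infinite_arbitrarily_large[of ?S "Suc (rank A)"] by blast
  have "1 \<le> dim (singular_space A \<sigma>)" if "\<sigma> \<in> T" for \<sigma>
    using that T(3) dim_singular_space_pos[of _ A \<sigma>] by (auto simp: Suc_le_eq)
  then have "card T \<le> (\<Sum>\<sigma>\<in>T. dim (singular_space A \<sigma>))"
    using sum_mono[of T "\<lambda>_. 1" "\<lambda>\<sigma>. dim (singular_space A \<sigma>)"] by simp
  also have "\<dots> \<le> rank A"
    using T by (intro sum_dim_singular_space_le_rank) auto
  finally show False using T(2) by simp
qed

lemma length_nonzero_singular_values_le_rank: "length (nonzero_singular_values A) \<le> rank A"
proof -
  let ?S = "{\<sigma>. 0 < \<sigma> \<and> (\<exists>v\<in>singular_space A \<sigma>. v \<noteq> 0)}"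
  have "length (nonzero_singular_values A) = (\<Sum>\<sigma>\<in>?S. dim (singular_space A \<sigma>))"
    unfolding nonzero_singular_values_def length_concat
    by (simp add: comp_def rev_map[symmetric] sum_list_distinct_conv_sum_set finite_singular_values)
  also have "\<dots> \<le> rank A"
    by (intro sum_dim_singular_space_le_rank finite_singular_values) auto
  finally show ?thesis .
qed

text \<open>
  Every positive singular value is one of \<open>singular_value i A\<close> with \<open>1 \<le> i \<le> rank A\<close>: the index at
  which it occurs in the list is in this range since the list has at most \<open>rank A\<close> entries.
\<close>
lemma singular_value_factor_le_rate:
  assumes "0 < \<sigma>" "v \<in> singular_space A \<sigma>" "v \<noteq> 0"
  shows "\<bar>1 - \<alpha> * \<sigma>\<^sup>2 / (frobenius_norm A)\<^sup>2\<bar> \<le> rebk_rate A \<alpha>"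
proof -
  have "\<sigma> \<in> set (nonzero_singular_values A)"
    using assms dim_singular_space_pos[OF assms(2,3)] finite_singular_values[of A]
    by (auto simp: nonzero_singular_values_def)
  then obtain i where "i < length (nonzero_singular_values A)" "\<sigma> = nonzero_singular_values A ! i"
    by (metis in_set_conv_nth)
  then have "\<sigma> = singular_value (Suc i) A" "Suc i \<in> {1..rank A}"
    using length_nonzero_singular_values_le_rank[of A] by (auto simp: singular_value_def)
  then show ?thesis
    unfolding rebk_rate_def by (auto intro!: Max_ge)
qed

text \<open>
  The map \<open>I - c A\<^sup>T A\<close>; with \<open>c = \<alpha> / \<parallel>A\<parallel>\<^sub>F\<^sup>2\<close> it is the averaged effect of a row step on the
  error, and the same map for \<open>A\<^sup>T\<close> is the averaged column step.
\<close>
definition gradient_step :: "real^'n^'m \<Rightarrow> real \<Rightarrow> real^'n \<Rightarrow> real^'n" where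
  "gradient_step A c v = v - c *\<^sub>R (transpose A *v (A *v v))"

lemma linear_gradient_step: "linear (gradient_step A c)"
  unfolding gradient_step_def
  by (intro linear_compose_sub linear_compose_scale_right linear_ident)
     (simp only: matrix_vector_mul_assoc matrix_vector_mul_linear)

lemma gradient_step_in_row_space:
  "v \<in> col_space (transpose A) \<Longrightarrow> gradient_step A c v \<in> col_space (transpose A)"
  unfolding gradient_step_def
  by (intro subspace_diff subspace_scale subspace_col_space) (auto simp only: col_space_def)

text \<open>
  On the row space the operator norm of \<open>I - c A\<^sup>T A\<close> is \<open>\<bar>l\<bar>\<close> for some eigenvalue \<open>l\<close>. Its
  eigenvector \<open>u\<close> satisfies \<open>A\<^sup>T A u = ((1 - l) / c) u\<close> and \<open>A u \<noteq> 0\<close>, as a nonzero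
  vector of the row space is not in the kernel, so \<open>(1 - l) / c\<close> is the square
  of a positive singular value \<open>\<sigma>\<close>, and \<open>l = 1 - c \<sigma>\<^sup>2\<close> is one of the factors in the definition of the
  rate.
\<close>
lemma norm_gradient_step_le:
  assumes "A \<noteq> 0" "\<alpha> > 0" and v: "v \<in> col_space (transpose A)"
  shows "norm (gradient_step A (\<alpha> / (frobenius_norm A)\<^sup>2) v) \<le> rebk_rate A \<alpha> * norm v"
proof (cases "v = 0")
  case True
  then show ?thesis by (simp add: linear_0[OF linear_gradient_step])
next
  case False
  define c where "c = \<alpha> / (frobenius_norm A)\<^sup>2"
  have c: "c > 0"
    using assms by (simp add: c_def frobenius_norm_eq_norm)
  have sym: "gradient_step A c x \<bullet> y = x \<bullet> gradient_step A c y" for x y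
    by (simp only: gradient_step_def inner_diff inner_scaleR_left inner_scaleR_right
        inner_matrix_transpose transpose_transpose)
  have nontrivial: "col_space (transpose A) \<noteq> {0}"
    using False v by blast
  have invariant: "gradient_step A c ` col_space (transpose A) \<subseteq> col_space (transpose A)"
    using gradient_step_in_row_space by blast
  obtain u l where u: "u \<in> col_space (transpose A)" "u \<noteq> 0" "gradient_step A c u = l *\<^sub>R u"
    and bound: "\<And>w. w \<in> col_space (transpose A) \<Longrightarrow> norm (gradient_step A c w) \<le> \<bar>l\<bar> * norm w"
    using symmetric_norm_attained_at_eigenvector[OF linear_gradient_step[of A c]
        subspace_col_space nontrivial invariant sym] by metis
  have Nu: "transpose A *v (A *v u) = ((1 - l) / c) *\<^sub>R u"
  proof -
    have "c *\<^sub>R (transpose A *v (A *v u)) = (1 - l) *\<^sub>R u"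
      using u(3) by (simp only: gradient_step_def) (simp add: algebra_simps)
    then have "(1 / c) *\<^sub>R c *\<^sub>R (transpose A *v (A *v u)) = (1 / c) *\<^sub>R (1 - l) *\<^sub>R u"
      by (simp only:)
    then show ?thesis using c by (simp only: scaleR_scaleR) simp
  qed
  have Au: "A *v u \<noteq> 0"
  proof
    assume "A *v u = 0"
    moreover obtain y where "u = transpose A *v y"
      using u(1) by (auto simp: col_space_def)
    ultimately show False
      using gram_kernel[of "transpose A" y] u(2) by simp
  qed
  have "(1 - l) / c * (u \<bullet> u) = (A *v u) \<bullet> (A *v u)"
    by (simp only: inner_matrix_transpose Nu inner_scaleR_right)
  then have pos: "(1 - l) / c > 0"
    using Au u(2) by (metis inner_gt_zero_iff zero_less_mult_pos2)
  define \<sigma> where "\<sigma> = sqrt ((1 - l) / c)"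
  have \<sigma>: "\<sigma> > 0" "\<sigma>\<^sup>2 = (1 - l) / c"
    using pos by (simp_all add: \<sigma>_def)
  have "\<bar>1 - \<alpha> * \<sigma>\<^sup>2 / (frobenius_norm A)\<^sup>2\<bar> \<le> rebk_rate A \<alpha>"
    using \<sigma> u(2) Nu by (intro singular_value_factor_le_rate) (auto simp only: singular_space_iff)
  moreover have "\<alpha> * \<sigma>\<^sup>2 / (frobenius_norm A)\<^sup>2 = c * \<sigma>\<^sup>2"
    by (simp add: c_def)
  ultimately have "\<bar>l\<bar> \<le> rebk_rate A \<alpha>"
    using c by (simp add: \<sigma>(2))
  then show ?thesis
    using bound[OF v] unfolding c_def[symmetric] by (meson mult_right_mono norm_ge_zero order_trans)
qed

section \<open>Expectation of randomly chosen affine maps\<close>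

text \<open>
  Independence of a pick \<open>Y\<close> and a random vector \<open>V\<close>, which take values in different types, whereas
  \<open>indep_var\<close> relates two variables of one type. It is therefore expressed by the real random
  variables \<open>indicator {j} (Y \<omega>)\<close> and \<open>V \<omega> \<bullet> e\<close>, which is all that expectations see.
\<close>
definition (in prob_space) pick_indep :: "('a \<Rightarrow> 'i) \<Rightarrow> ('a \<Rightarrow> 'v::euclidean_space) \<Rightarrow> bool" where
  "pick_indep Y V \<longleftrightarrow> Y \<in> measurable M (count_space UNIV) \<and>
     (\<forall>j e. indep_var borel (\<lambda>\<omega>. indicator {j} (Y \<omega>) :: real) borel (\<lambda>\<omega>. V \<omega> \<bullet> e))"

lemma (in prob_space) expectation_indicator_indep:
  fixes V :: "'a \<Rightarrow> 'v::euclidean_space" and Y :: "'a \<Rightarrow> 'i"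
  assumes ind: "pick_indep Y V" and V: "integrable M V"
  shows "integrable M (\<lambda>\<omega>. indicator {j} (Y \<omega>) *\<^sub>R V \<omega>)"
    and "integral\<^sup>L M (\<lambda>\<omega>. indicator {j} (Y \<omega>) *\<^sub>R V \<omega>)
           = prob {\<omega> \<in> space M. Y \<omega> = j} *\<^sub>R integral\<^sup>L M V"
proof -
  have Y: "Y \<in> measurable M (count_space UNIV)"
    using ind by (simp add: pick_indep_def)
  have meas: "(\<lambda>\<omega>. indicator {j} (Y \<omega>) :: real) \<in> borel_measurable M"
    by (rule measurable_compose[OF Y]) simp
  show int: "integrable M (\<lambda>\<omega>. indicator {j} (Y \<omega>) *\<^sub>R V \<omega>)"
    by (rule Bochner_Integration.integrable_bound[OF V])
      (use meas V in \<open>auto simp: indicator_def\<close>)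
  have int1: "integrable M (\<lambda>\<omega>. indicator {j} (Y \<omega>) :: real)"
    by (rule integrable_const_bound[where B = 1]) (use meas in \<open>auto simp: indicator_def\<close>)
  have "(\<integral>\<omega>. indicator {j} (Y \<omega>) \<partial>M) = (\<integral>\<omega>. indicator {\<omega> \<in> space M. Y \<omega> = j} \<omega> \<partial>M)"
    by (rule Bochner_Integration.integral_cong) (auto simp: indicator_def)
  also have "\<dots> = prob {\<omega> \<in> space M. Y \<omega> = j}"
    by (simp add: Int_absorb2)
  finally have prob: "(\<integral>\<omega>. indicator {j} (Y \<omega>) \<partial>M) = prob {\<omega> \<in> space M. Y \<omega> = j}" .
  show "integral\<^sup>L M (\<lambda>\<omega>. indicator {j} (Y \<omega>) *\<^sub>R V \<omega>)
           = prob {\<omega> \<in> space M. Y \<omega> = j} *\<^sub>R integral\<^sup>L M V"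
  proof (rule euclidean_eqI)
    fix e :: 'v
    have "indep_var borel (\<lambda>\<omega>. indicator {j} (Y \<omega>) :: real) borel (\<lambda>\<omega>. V \<omega> \<bullet> e)"
      using ind by (simp add: pick_indep_def)
    then have "(\<integral>\<omega>. indicator {j} (Y \<omega>) * (V \<omega> \<bullet> e) \<partial>M)
        = prob {\<omega> \<in> space M. Y \<omega> = j} * (\<integral>\<omega>. V \<omega> \<bullet> e \<partial>M)"
      using indep_var_lebesgue_integral[OF _ int1, of "\<lambda>\<omega>. V \<omega> \<bullet> e"] V prob by simp
    moreover have "integral\<^sup>L M (\<lambda>\<omega>. indicator {j} (Y \<omega>) *\<^sub>R V \<omega>) \<bullet> e
        = (\<integral>\<omega>. (indicator {j} (Y \<omega>) *\<^sub>R V \<omega>) \<bullet> e \<partial>M)"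
      by (rule integral_inner_left[symmetric]) (rule int)
    ultimately show "integral\<^sup>L M (\<lambda>\<omega>. indicator {j} (Y \<omega>) *\<^sub>R V \<omega>) \<bullet> e
           = (prob {\<omega> \<in> space M. Y \<omega> = j} *\<^sub>R integral\<^sup>L M V) \<bullet> e"
      using V by simp
  qed
qed

text \<open>
  An affine map chosen independently of its argument may be averaged first:
  \<open>E (T\<^sub>Y V)\<close> splits over the events \<open>Y = j\<close>, and each summand factors by independence and
  affinity.
\<close>
lemma (in prob_space) expectation_random_affine_map:
  fixes V :: "'a \<Rightarrow> 'v::euclidean_space" and T :: "'i \<Rightarrow> 'v \<Rightarrow> 'u::euclidean_space"
  assumes ind: "pick_indep Y V"
    and fin: "finite S" and range: "\<And>\<omega>. \<omega> \<in> space M \<Longrightarrow> Y \<omega> \<in> S"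
    and V: "integrable M V"
    and T: "\<And>j. linear (\<lambda>v. T j v - T j 0)"
  shows "integrable M (\<lambda>\<omega>. T (Y \<omega>) (V \<omega>))"
    and "integral\<^sup>L M (\<lambda>\<omega>. T (Y \<omega>) (V \<omega>))
           = (\<Sum>j\<in>S. prob {\<omega> \<in> space M. Y \<omega> = j} *\<^sub>R T j (integral\<^sup>L M V))"
proof -
  let ?L = "\<lambda>j v. T j v - T j 0" and ?p = "\<lambda>j. prob {\<omega> \<in> space M. Y \<omega> = j}"
  have L: "bounded_linear (?L j)" for j
    using T linear_conv_bounded_linear by blast
  have split: "T (Y \<omega>) (V \<omega>) = (\<Sum>j\<in>S. ?L j (indicator {j} (Y \<omega>) *\<^sub>R V \<omega>) + indicator {j} (Y \<omega>) *\<^sub>R T j 0)"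
    if "\<omega> \<in> space M" for \<omega>
  proof -
    have "?L j (indicator {j} (Y \<omega>) *\<^sub>R V \<omega>) + indicator {j} (Y \<omega>) *\<^sub>R T j 0
        = (if j = Y \<omega> then T j (V \<omega>) else 0)" for j
      by (auto simp: indicator_def)
    then show ?thesis
      using fin range[OF that] by (simp add: sum.delta)
  qed
  have "pick_indep Y (\<lambda>\<omega>. T j 0)" for j
    unfolding pick_indep_def
  proof (intro conjI allI)
    show "Y \<in> measurable M (count_space UNIV)"
      using ind by (simp add: pick_indep_def)
    fix i e
    have "indep_var borel (\<lambda>\<omega>. indicator {i} (Y \<omega>) :: real) borel (\<lambda>\<omega>. V \<omega> \<bullet> 0)"
      using ind unfolding pick_indep_def by blast
    from indep_var_compose[OF this, of id borel "\<lambda>_. T j 0 \<bullet> e" borel]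
    show "indep_var borel (\<lambda>\<omega>. indicator {i} (Y \<omega>) :: real) borel (\<lambda>\<omega>. T j 0 \<bullet> e)"
      by (simp add: comp_def)
  qed
  note const = expectation_indicator_indep[OF this]
  note pick = expectation_indicator_indep[OF ind V]
  have int: "integrable M (\<lambda>\<omega>. ?L j (indicator {j} (Y \<omega>) *\<^sub>R V \<omega>) + indicator {j} (Y \<omega>) *\<^sub>R T j 0)" for j
    using integrable_bounded_linear[OF L pick(1), of j j] const(1)[of j j] by simp
  show "integrable M (\<lambda>\<omega>. T (Y \<omega>) (V \<omega>))"
    by (subst Bochner_Integration.integrable_cong[OF refl split])
      (use int in \<open>auto intro!: Bochner_Integration.integrable_sum\<close>)
  have "integral\<^sup>L M (\<lambda>\<omega>. T (Y \<omega>) (V \<omega>))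
      = (\<Sum>j\<in>S. \<integral>\<omega>. ?L j (indicator {j} (Y \<omega>) *\<^sub>R V \<omega>) + indicator {j} (Y \<omega>) *\<^sub>R T j 0 \<partial>M)"
    by (subst Bochner_Integration.integral_cong[OF refl split])
      (use int in \<open>auto intro!: Bochner_Integration.integral_sum\<close>)
  also have "\<dots> = (\<Sum>j\<in>S. ?p j *\<^sub>R T j (integral\<^sup>L M V))"
  proof (rule sum.cong[OF refl])
    fix j
    have "(\<integral>\<omega>. ?L j (indicator {j} (Y \<omega>) *\<^sub>R V \<omega>) + indicator {j} (Y \<omega>) *\<^sub>R T j 0 \<partial>M)
        = (\<integral>\<omega>. ?L j (indicator {j} (Y \<omega>) *\<^sub>R V \<omega>) \<partial>M) + (\<integral>\<omega>. indicator {j} (Y \<omega>) *\<^sub>R T j 0 \<partial>M)"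
      by (rule Bochner_Integration.integral_add)
        (use integrable_bounded_linear[OF L pick(1), of j j] const(1)[of j j] in simp_all)
    also have "(\<integral>\<omega>. ?L j (indicator {j} (Y \<omega>) *\<^sub>R V \<omega>) \<partial>M) = ?L j (?p j *\<^sub>R integral\<^sup>L M V)"
      using integral_bounded_linear[OF L pick(1), of j j] pick(2)[of j] by simp
    also have "\<dots> = ?p j *\<^sub>R ?L j (integral\<^sup>L M V)"
      using linear_scale[OF T[of j]] by simp
    also have "(\<integral>\<omega>. indicator {j} (Y \<omega>) *\<^sub>R T j 0 \<partial>M) = ?p j *\<^sub>R T j 0"
      using const(2)[of j j] by (simp add: prob_space)
    finally show "(\<integral>\<omega>. ?L j (indicator {j} (Y \<omega>) *\<^sub>R V \<omega>) + indicator {j} (Y \<omega>) *\<^sub>R T j 0 \<partial>M)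
        = ?p j *\<^sub>R T j (integral\<^sup>L M V)"
      by (simp add: scaleR_diff_right)
  qed
  finally show "integral\<^sup>L M (\<lambda>\<omega>. T (Y \<omega>) (V \<omega>)) = (\<Sum>j\<in>S. ?p j *\<^sub>R T j (integral\<^sup>L M V))" .
qed

text \<open>
  In a family of independent picks, each pick is independent of everything computed from the
  others. The index set \<open>K\<close> collects the picks that \<open>V\<close> depends on.
\<close>
lemma (in prob_space) pick_indep_of_history:
  fixes P :: "'i \<Rightarrow> 'a \<Rightarrow> 'c" and f :: "('i \<Rightarrow> 'c) \<Rightarrow> 'v::euclidean_space"
  assumes ind: "indep_vars (\<lambda>_. count_space UNIV) P N" and K: "q \<in> N" "K \<subseteq> N" "q \<notin> K"
    and f: "f \<in> measurable (PiM K (\<lambda>_. count_space UNIV)) borel"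
    and V: "\<And>\<omega>. V \<omega> = f (restrict (\<lambda>i. P i \<omega>) K)"
  shows "pick_indep (P q) V"
  unfolding pick_indep_def
proof (intro conjI allI)
  show "P q \<in> measurable M (count_space UNIV)"
    using ind K by (auto simp: indep_vars_def2)
  fix j e
  have "indep_var (PiM {q} (\<lambda>_. count_space UNIV)) (\<lambda>\<omega>. restrict (\<lambda>i. P i \<omega>) {q})
          (PiM K (\<lambda>_. count_space UNIV)) (\<lambda>\<omega>. restrict (\<lambda>i. P i \<omega>) K)"
    using ind K by (intro indep_var_restrict) auto
  moreover have "(\<lambda>p :: 'i \<Rightarrow> 'c. indicator {j} (p q) :: real) \<in> measurable (PiM {q} (\<lambda>_. count_space UNIV)) borel"
    by (rule measurable_compose[OF measurable_component_singleton]) auto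
  moreover have "(\<lambda>p. f p \<bullet> e) \<in> measurable (PiM K (\<lambda>_. count_space UNIV)) borel"
    using f by measurable
  ultimately have "indep_var borel ((\<lambda>p :: 'i \<Rightarrow> 'c. indicator {j} (p q) :: real) \<circ> (\<lambda>\<omega>. restrict (\<lambda>i. P i \<omega>) {q}))
      borel ((\<lambda>p. f p \<bullet> e) \<circ> (\<lambda>\<omega>. restrict (\<lambda>i. P i \<omega>) K))"
    by (rule indep_var_compose)
  then show "indep_var borel (\<lambda>\<omega>. indicator {j} (P q \<omega>) :: real) borel (\<lambda>\<omega>. V \<omega> \<bullet> e)"
    by (simp add: comp_def V)
qed

section \<open>Averaging one block step\<close>
lemma frobenius_norm_transpose: "frobenius_norm (transpose A) = frobenius_norm A"
  unfolding frobenius_norm_def transpose_def by simp (rule sum.swap)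

text \<open>
  Column blocks are treated as row blocks of \<open>A\<^sup>T\<close>, so that one averaging lemma serves both steps.
\<close>
lemma col_block_eq_transpose: "col_block A J = transpose (row_block (transpose A) J)"
  by (simp add: col_block_def row_block_def transpose_def vec_eq_iff)

text \<open>
  The transposed block ignores all coordinates outside \<open>I\<close>, so the residual of the block may be
  replaced by the residual of the whole system.
\<close>
lemma row_block_inner_step:
  "transpose (row_block A I) *v (row_block A I *v x - subvec b I + subvec z I)
     = transpose (row_block A I) *v (A *v x - b + z)"
  by (auto simp: vec_eq_iff matrix_vector_mult_def transpose_def row_block_def subvec_def intro!: sum.cong)

lemma rebk_x_step_eq:
  "rebk_x_step A b \<alpha> I z x
     = x - (\<alpha> / (frobenius_norm (row_block A I))\<^sup>2) *\<^sub>R (transpose (row_block A I) *v (A *v x - b + z))"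
  by (simp only: rebk_x_step_def row_block_inner_step)

lemma rebk_z_step_eq:
  fixes A :: "real^'n^'m"
  shows
  "rebk_z_step A \<alpha> J z
     = z - (\<alpha> / (frobenius_norm (row_block (transpose A) J))\<^sup>2) *\<^sub>R
             (transpose (row_block (transpose A) J) *v (transpose A *v z))"
proof -
  have "subvec (0 :: real^'n) J = 0"
    by (simp add: subvec_def vec_eq_iff)
  with row_block_inner_step[of "transpose A" J z 0 0]
  show ?thesis
    by (simp only: rebk_z_step_def col_block_eq_transpose frobenius_norm_transpose transpose_transpose diff_0_right add_0_right)
qed

lemma sum_over_block_partition:
  fixes f :: "'m::finite \<Rightarrow> 'a::comm_monoid_add"
  assumes "block_partition P s"
  shows "(\<Sum>i\<in>{1..s}. \<Sum>l\<in>P i. f l) = (\<Sum>l\<in>UNIV. f l)"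
proof -
  have "(\<Sum>l\<in>(\<Union>i\<in>{1..s}. P i). f l) = (\<Sum>i\<in>{1..s}. \<Sum>l\<in>P i. f l)"
    using assms by (intro sum.UNION_disjoint) (auto simp: block_partition_def disjoint_family_on_def)
  then show ?thesis
    using assms by (simp add: block_partition_def)
qed

lemma sum_transpose_row_block:
  fixes A :: "real^'n^'m"
  assumes "block_partition P s"
  shows "(\<Sum>i\<in>{1..s}. transpose (row_block A (P i)) *v w) = transpose A *v w"
proof (subst vec_eq_iff, rule allI)
  fix j
  have "(transpose (row_block A (P i)) *v w) $ j = (\<Sum>l\<in>P i. A $ l $ j * w $ l)" for i
    by (simp only: matrix_vector_mult_def transpose_def row_block_def vec_lambda_beta)
       (simp add: if_distrib[where f = "\<lambda>a. a * _"] sum.If_cases cong: if_cong)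
  then show "(\<Sum>i\<in>{1..s}. transpose (row_block A (P i)) *v w) $ j = (transpose A *v w) $ j"
    using sum_over_block_partition[OF assms, of "\<lambda>l. A $ l $ j * w $ l"]
    by (simp only: sum_component) (simp only: matrix_vector_mult_def transpose_def vec_lambda_beta)
qed

lemma sum_frobenius_norm_row_block:
  fixes A :: "real^'n^'m"
  assumes "block_partition P s"
  shows "(\<Sum>i\<in>{1..s}. (frobenius_norm (row_block A (P i)))\<^sup>2) = (frobenius_norm A)\<^sup>2"
proof -
  have "(frobenius_norm (row_block A I))\<^sup>2 = (\<Sum>l\<in>I. \<Sum>j\<in>UNIV. (A $ l $ j)\<^sup>2)" for I
  proof -
    have "(frobenius_norm (row_block A I))\<^sup>2 = (\<Sum>l\<in>UNIV. if l \<in> I then \<Sum>j\<in>UNIV. (A $ l $ j)\<^sup>2 else 0)"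
      unfolding frobenius_norm_def row_block_def
      by (subst real_sqrt_pow2) (auto intro!: sum_nonneg sum.cong)
    then show ?thesis
      by (simp add: sum.If_cases)
  qed
  then show ?thesis
    using sum_over_block_partition[OF assms, of "\<lambda>l. \<Sum>j\<in>UNIV. (A $ l $ j)\<^sup>2"]
    by (simp add: frobenius_norm_def sum_nonneg)
qed

text \<open>
  The squared Frobenius norm in the selection probability cancels the one in the step size, so the
  average of the block steps is a full gradient step. A zero block, for which the step size involves
  a division by zero, has weight zero and a vanishing transposed block, so it contributes nothing on
  either side.
\<close>
lemma mean_row_block_step:
  fixes A :: "real^'n^'m"
  assumes P: "block_partition P s" and A: "A \<noteq> 0"
  shows "(\<Sum>i\<in>{1..s}. ((frobenius_norm (row_block A (P i)))\<^sup>2 / (frobenius_norm A)\<^sup>2) *\<^sub>R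
            (x - (\<alpha> / (frobenius_norm (row_block A (P i)))\<^sup>2) *\<^sub>R (transpose (row_block A (P i)) *v w)))
         = x - (\<alpha> / (frobenius_norm A)\<^sup>2) *\<^sub>R (transpose A *v w)"
proof -
  let ?F = "(frobenius_norm A)\<^sup>2" and ?R = "\<lambda>i. row_block A (P i)"
  have F: "?F \<noteq> 0"
    using A by (simp add: frobenius_norm_eq_norm)
  have summand: "((frobenius_norm (?R i))\<^sup>2 / ?F) *\<^sub>R
            (x - (\<alpha> / (frobenius_norm (?R i))\<^sup>2) *\<^sub>R (transpose (?R i) *v w))
      = ((frobenius_norm (?R i))\<^sup>2 / ?F) *\<^sub>R x - (\<alpha> / ?F) *\<^sub>R (transpose (?R i) *v w)" for i
  proof (cases "?R i = 0")
    case True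
    have "transpose (0 :: real^'n^'m) *v w = 0"
      by (simp add: vec_eq_iff matrix_vector_mult_def transpose_def del: transpose_matrix_vector)
    then show ?thesis by (simp only: True) (simp add: frobenius_norm_eq_norm)
  next
    case False
    then show ?thesis
      by (simp add: frobenius_norm_eq_norm scaleR_diff_right)
  qed
  have "(\<Sum>i\<in>{1..s}. ((frobenius_norm (?R i))\<^sup>2 / ?F) *\<^sub>R
            (x - (\<alpha> / (frobenius_norm (?R i))\<^sup>2) *\<^sub>R (transpose (?R i) *v w)))
      = (\<Sum>i\<in>{1..s}. (frobenius_norm (?R i))\<^sup>2 / ?F) *\<^sub>R x
          - (\<alpha> / ?F) *\<^sub>R (\<Sum>i\<in>{1..s}. transpose (?R i) *v w)"
    by (simp only: summand sum_subtractf scaleR_sum_left scaleR_sum_right)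
  also have "(\<Sum>i\<in>{1..s}. (frobenius_norm (?R i))\<^sup>2 / ?F) = 1"
    using sum_frobenius_norm_row_block[OF P, of A] F by (simp add: sum_divide_distrib[symmetric])
  finally show ?thesis
    by (simp only: sum_transpose_row_block[OF P] scaleR_one)
qed

section \<open>Dependence of the iterates on the picks\<close>

text \<open>
  The iterates of step \<open>k\<close> depend only on the picks with index at most \<open>k\<close>, and measurably so; this is
  what makes them independent of the next pick.
\<close>
lemma rebk_z_cong:
  "(\<And>l. l \<in> {1..k} \<Longrightarrow> jp l = jp' l) \<Longrightarrow> rebk_z A \<alpha> J z0 jp k = rebk_z A \<alpha> J z0 jp' k"
  by (induction k) auto

lemma rebk_x_cong:
  "(\<And>l. l \<in> {1..k} \<Longrightarrow> jp l = jp' l) \<Longrightarrow> (\<And>l. l \<in> {1..k} \<Longrightarrow> ip l = ip' l)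
     \<Longrightarrow> rebk_x A b \<alpha> I J z0 x0 jp ip k = rebk_x A b \<alpha> I J z0 x0 jp' ip' k"
proof (induction k)
  case (Suc k)
  have "rebk_z A \<alpha> J z0 jp (Suc k) = rebk_z A \<alpha> J z0 jp' (Suc k)"
    by (rule rebk_z_cong) (rule Suc.prems)
  moreover have "rebk_x A b \<alpha> I J z0 x0 jp ip k = rebk_x A b \<alpha> I J z0 x0 jp' ip' k"
    by (rule Suc.IH) (use Suc.prems in auto)
  ultimately show ?case
    using Suc.prems(2)[of "Suc k"] by (simp del: rebk_z.simps)
qed simp

lemma borel_measurable_matrix_vector_mult [measurable]:
  fixes A :: "real^'n^'m"
  shows "(\<lambda>x. A *v x) \<in> borel_measurable borel"
  by (intro borel_measurable_continuous_onI linear_continuous_on matrix_vector_mul_bounded_linear)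

lemma rebk_z_measurable:
  assumes "\<And>l. l \<in> {1..k} \<Longrightarrow> jp l \<in> measurable N (count_space UNIV)"
  shows "(\<lambda>\<omega>. rebk_z A \<alpha> J z0 (\<lambda>l. jp l \<omega>) k) \<in> borel_measurable N"
  using assms
proof (induction k)
  case (Suc k)
  have [measurable]: "(\<lambda>\<omega>. rebk_z A \<alpha> J z0 (\<lambda>l. jp l \<omega>) k) \<in> borel_measurable N"
    by (rule Suc.IH) (use Suc.prems in auto)
  have "(\<lambda>\<omega>. rebk_z_step A \<alpha> (J j) (rebk_z A \<alpha> J z0 (\<lambda>l. jp l \<omega>) k)) \<in> borel_measurable N" for j
    unfolding rebk_z_step_eq by measurable
  from measurable_compose_countable[OF this Suc.prems[of "Suc k"]] show ?case
    by simp
qed simp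

lemma rebk_x_measurable:
  assumes "\<And>l. l \<in> {1..k} \<Longrightarrow> jp l \<in> measurable N (count_space UNIV)"
    and "\<And>l. l \<in> {1..k} \<Longrightarrow> ip l \<in> measurable N (count_space UNIV)"
  shows "(\<lambda>\<omega>. rebk_x A b \<alpha> I J z0 x0 (\<lambda>l. jp l \<omega>) (\<lambda>l. ip l \<omega>) k) \<in> borel_measurable N"
  using assms
proof (induction k)
  case (Suc k)
  have [measurable]: "(\<lambda>\<omega>. rebk_x A b \<alpha> I J z0 x0 (\<lambda>l. jp l \<omega>) (\<lambda>l. ip l \<omega>) k) \<in> borel_measurable N"
    by (rule Suc.IH) (use Suc.prems in auto)
  have [measurable]: "(\<lambda>\<omega>. rebk_z A \<alpha> J z0 (\<lambda>l. jp l \<omega>) (Suc k)) \<in> borel_measurable N"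
    by (rule rebk_z_measurable) (rule Suc.prems)
  note rebk_z.simps(2) [simp del]
  have "(\<lambda>\<omega>. rebk_x_step A b \<alpha> (I i) (rebk_z A \<alpha> J z0 (\<lambda>l. jp l \<omega>) (Suc k))
          (rebk_x A b \<alpha> I J z0 x0 (\<lambda>l. jp l \<omega>) (\<lambda>l. ip l \<omega>) k)) \<in> borel_measurable N" for i
    unfolding rebk_x_step_eq by measurable
  from measurable_compose_countable[OF this Suc.prems(2)[of "Suc k"]] show ?case
    by simp
qed simp


section \<open>The mean iteration\<close>
lemma integral_Pair:
  fixes f :: "'w \<Rightarrow> 'a::euclidean_space" and g :: "'w \<Rightarrow> 'b::euclidean_space"
  assumes f: "integrable M f" and g: "integrable M g"
  shows "integrable M (\<lambda>\<omega>. (f \<omega>, g \<omega>))"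
    and "integral\<^sup>L M (\<lambda>\<omega>. (f \<omega>, g \<omega>)) = (integral\<^sup>L M f, integral\<^sup>L M g)"
proof -
  have L: "bounded_linear (\<lambda>x :: 'a. (x, 0 :: 'b))" "bounded_linear (\<lambda>y :: 'b. (0 :: 'a, y))"
    by (intro bounded_linear_Pair bounded_linear_ident bounded_linear_zero)+
  have eq: "(\<lambda>\<omega>. (f \<omega>, g \<omega>)) = (\<lambda>\<omega>. (f \<omega>, 0) + (0, g \<omega>))"
    by simp
  show "integrable M (\<lambda>\<omega>. (f \<omega>, g \<omega>))"
    unfolding eq by (intro Bochner_Integration.integrable_add integrable_bounded_linear[OF L(1) f]
        integrable_bounded_linear[OF L(2) g])
  show "integral\<^sup>L M (\<lambda>\<omega>. (f \<omega>, g \<omega>)) = (integral\<^sup>L M f, integral\<^sup>L M g)"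
    unfolding eq Bochner_Integration.integral_add[OF integrable_bounded_linear[OF L(1) f]
        integrable_bounded_linear[OF L(2) g]] integral_bounded_linear[OF L(1) f] integral_bounded_linear[OF L(2) g]
    by simp
qed

lemma rebk_picks_prob_space: "rebk_picks M A I s J t jp ip \<Longrightarrow> prob_space M"
  by (simp add: rebk_picks_def)

lemma rebk_z_expectation:
  fixes A :: "real^'n^'m"
  assumes "A \<noteq> 0" and J: "block_partition J t" and picks: "rebk_picks M A I s J t jp ip"
  shows "integrable M (\<lambda>\<omega>. rebk_z A \<alpha> J z0 (\<lambda>l. jp l \<omega>) k)" (is "integrable M (?Z k)")
    and "integral\<^sup>L M (\<lambda>\<omega>. rebk_z A \<alpha> J z0 (\<lambda>l. jp l \<omega>) k)
           = (gradient_step (transpose A) (\<alpha> / (frobenius_norm A)\<^sup>2) ^^ k) z0"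
proof -
  interpret prob_space M
    using picks by (rule rebk_picks_prob_space)
  let ?c = "\<alpha> / (frobenius_norm A)\<^sup>2" and ?P = "case_sum jp ip"
  let ?R = "\<lambda>j. row_block (transpose A) (J j)"
  have "integrable M (?Z k) \<and> integral\<^sup>L M (?Z k) = (gradient_step (transpose A) ?c ^^ k) z0"
  proof (induction k)
    case 0
    then show ?case by (simp add: prob_space)
  next
    case (Suc k)
    let ?K = "Inl ` {1..k}" and ?f = "\<lambda>p. rebk_z A \<alpha> J z0 (\<lambda>l. p (Inl l)) k"
    have "pick_indep (?P (Inl (Suc k))) (?Z k)"
    proof (rule pick_indep_of_history)
      show "indep_vars (\<lambda>_. count_space UNIV) ?P ({1..} <+> {1..})"
        using picks by (simp add: rebk_picks_def)
      show "?f \<in> measurable (PiM ?K (\<lambda>_. count_space UNIV)) borel"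
        by (rule rebk_z_measurable) (auto intro!: measurable_component_singleton)
      show "?Z k \<omega> = ?f (restrict (\<lambda>i. ?P i \<omega>) ?K)" for \<omega>
        by (rule rebk_z_cong) auto
    qed auto
    then have ind: "pick_indep (jp (Suc k)) (?Z k)" by simp
    have range: "jp (Suc k) \<omega> \<in> {1..t}" if "\<omega> \<in> space M" for \<omega>
      using picks that by (simp add: rebk_picks_def)
    have lin: "linear (\<lambda>z. rebk_z_step A \<alpha> (J j) z - rebk_z_step A \<alpha> (J j) 0)" for j
    proof -
      have "linear (\<lambda>z. z - (\<alpha> / (frobenius_norm (?R j))\<^sup>2) *\<^sub>R ((transpose (?R j) ** transpose A) *v z))"
        by (intro linear_compose_sub linear_compose_scale_right linear_ident matrix_vector_mul_linear)
      then show ?thesis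
        by (simp only: rebk_z_step_eq matrix_vector_mul_assoc matrix_vector_mult_0_right
            scaleR_zero_right diff_0_right)
    qed
    note step = expectation_random_affine_map[OF ind finite_atLeastAtMost range conjunct1[OF Suc.IH] lin]
    have "integral\<^sup>L M (?Z (Suc k)) = (\<Sum>j\<in>{1..t}. prob {\<omega> \<in> space M. jp (Suc k) \<omega> = j} *\<^sub>R
             rebk_z_step A \<alpha> (J j) (integral\<^sup>L M (?Z k)))"
      using step(2) by simp
    also have "\<dots> = (\<Sum>j\<in>{1..t}. ((frobenius_norm (?R j))\<^sup>2 / (frobenius_norm (transpose A))\<^sup>2) *\<^sub>R
             rebk_z_step A \<alpha> (J j) (integral\<^sup>L M (?Z k)))"
    proof (rule sum.cong[OF refl])
      fix j assume "j \<in> {1..t}"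
      moreover have "frobenius_norm (col_block A (J j)) = frobenius_norm (?R j)"
        by (metis col_block_eq_transpose frobenius_norm_transpose)
      ultimately have "prob {\<omega> \<in> space M. jp (Suc k) \<omega> = j}
          = (frobenius_norm (?R j))\<^sup>2 / (frobenius_norm (transpose A))\<^sup>2"
        using picks by (simp add: rebk_picks_def frobenius_norm_transpose)
      then show "prob {\<omega> \<in> space M. jp (Suc k) \<omega> = j} *\<^sub>R rebk_z_step A \<alpha> (J j) (integral\<^sup>L M (?Z k))
          = ((frobenius_norm (?R j))\<^sup>2 / (frobenius_norm (transpose A))\<^sup>2) *\<^sub>R
             rebk_z_step A \<alpha> (J j) (integral\<^sup>L M (?Z k))"
        by simp
    qed
    also have "\<dots> = gradient_step (transpose A) ?c (integral\<^sup>L M (?Z k))"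
    proof -
      have "transpose A \<noteq> 0"
        using assms(1) by (metis frobenius_norm_eq_norm frobenius_norm_transpose norm_eq_zero)
      from mean_row_block_step[OF J this] show ?thesis
        by (simp only: rebk_z_step_eq gradient_step_def frobenius_norm_transpose)
    qed
    finally show ?case
      using step(1) Suc.IH by simp
  qed
  then show "integrable M (?Z k)" "integral\<^sup>L M (?Z k) = (gradient_step (transpose A) ?c ^^ k) z0"
    by auto
qed

text \<open>
  The row pick \<open>i\<close> of iteration \<open>k + 1\<close> is independent of the pair of the previous iterate \<open>x\<close> and
  the current iterate \<open>z\<close>, although these two are dependent in general; the step is affine in the pair.
\<close>
lemma rebk_x_expectation_step:
  fixes A :: "real^'n^'m"
  assumes A: "A \<noteq> 0" and I: "block_partition I s" and J: "block_partition J t"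
    and picks: "rebk_picks M A I s J t jp ip"
    and X: "integrable M (\<lambda>\<omega>. rebk_x A b \<alpha> I J z0 x0 (\<lambda>l. jp l \<omega>) (\<lambda>l. ip l \<omega>) k)"
      (is "integrable M (?X k)")
  shows "integrable M (\<lambda>\<omega>. rebk_x A b \<alpha> I J z0 x0 (\<lambda>l. jp l \<omega>) (\<lambda>l. ip l \<omega>) (Suc k))"
    and "integral\<^sup>L M (\<lambda>\<omega>. rebk_x A b \<alpha> I J z0 x0 (\<lambda>l. jp l \<omega>) (\<lambda>l. ip l \<omega>) (Suc k))
         = integral\<^sup>L M (\<lambda>\<omega>. rebk_x A b \<alpha> I J z0 x0 (\<lambda>l. jp l \<omega>) (\<lambda>l. ip l \<omega>) k)
           - (\<alpha> / (frobenius_norm A)\<^sup>2) *\<^sub>R (transpose A *v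
               (A *v integral\<^sup>L M (\<lambda>\<omega>. rebk_x A b \<alpha> I J z0 x0 (\<lambda>l. jp l \<omega>) (\<lambda>l. ip l \<omega>) k) - b
                + integral\<^sup>L M (\<lambda>\<omega>. rebk_z A \<alpha> J z0 (\<lambda>l. jp l \<omega>) (Suc k))))"
proof -
  interpret prob_space M
    using picks by (rule rebk_picks_prob_space)
  \<comment> \<open>The current iterate \<open>z\<close> is kept as one random vector, not unfolded into its last step.\<close>
  note rebk_z.simps(2) [simp del]
  let ?P = "case_sum jp ip" and ?Z = "\<lambda>\<omega>. rebk_z A \<alpha> J z0 (\<lambda>l. jp l \<omega>) (Suc k)"
  let ?V = "\<lambda>\<omega>. (?X k \<omega>, ?Z \<omega>)" and ?T = "\<lambda>i v. rebk_x_step A b \<alpha> (I i) (snd v) (fst v)"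
  let ?K = "Inl ` {1..Suc k} \<union> Inr ` {1..k}"
  let ?f = "\<lambda>p. (rebk_x A b \<alpha> I J z0 x0 (\<lambda>l. p (Inl l)) (\<lambda>l. p (Inr l)) k,
                 rebk_z A \<alpha> J z0 (\<lambda>l. p (Inl l)) (Suc k))"
  have "pick_indep (?P (Inr (Suc k))) ?V"
  proof (rule pick_indep_of_history)
    show "indep_vars (\<lambda>_. count_space UNIV) ?P ({1..} <+> {1..})"
      using picks by (simp add: rebk_picks_def)
    show "?f \<in> measurable (PiM ?K (\<lambda>_. count_space UNIV)) borel"
      by (intro borel_measurable_Pair rebk_x_measurable rebk_z_measurable)
         (auto intro!: measurable_component_singleton)
    show "?V \<omega> = ?f (restrict (\<lambda>i. ?P i \<omega>) ?K)" for \<omega>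
    proof (rule prod_eqI)
      show "fst (?V \<omega>) = fst (?f (restrict (\<lambda>i. ?P i \<omega>) ?K))"
        unfolding fst_conv by (rule rebk_x_cong) auto
      show "snd (?V \<omega>) = snd (?f (restrict (\<lambda>i. ?P i \<omega>) ?K))"
        unfolding snd_conv by (rule rebk_z_cong) auto
    qed
  qed auto
  then have ind: "pick_indep (ip (Suc k)) ?V" by simp
  have range: "ip (Suc k) \<omega> \<in> {1..s}" if "\<omega> \<in> space M" for \<omega>
    using picks that by (simp add: rebk_picks_def)
  have Z: "integrable M ?Z"
    by (rule rebk_z_expectation[OF A J picks])
  have V: "integrable M ?V"
    using X Z by (rule integral_Pair(1))
  have EV: "integral\<^sup>L M ?V = (integral\<^sup>L M (?X k), integral\<^sup>L M ?Z)"
    using X Z by (rule integral_Pair(2))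
  have lin: "linear (\<lambda>v. ?T i v - ?T i 0)" for i
  proof -
    let ?r = "\<alpha> / (frobenius_norm (row_block A (I i)))\<^sup>2" and ?Rt = "transpose (row_block A (I i))"
    have "?T i v - ?T i 0 = fst v - ?r *\<^sub>R ((?Rt ** A) *v fst v + ?Rt *v snd v)" for v
      by (simp only: rebk_x_step_eq matrix_vector_mul_assoc[symmetric] matrix_vector_mult_diff_distrib
           matrix_vector_right_distrib fst_zero snd_zero matrix_vector_mult_0_right)
         (simp add: algebra_simps)
    moreover have "linear (\<lambda>v. fst v - ?r *\<^sub>R ((?Rt ** A) *v fst v + ?Rt *v snd v))"
      by (intro linear_compose_sub linear_compose_add linear_compose_scale_right linear_fst
          linear_compose[OF linear_fst matrix_vector_mul_linear, unfolded comp_def]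
          linear_compose[OF linear_snd matrix_vector_mul_linear, unfolded comp_def])
    ultimately show ?thesis by presburger
  qed
  note step = expectation_random_affine_map[OF ind finite_atLeastAtMost range V lin]
  show "integrable M (?X (Suc k))"
    using step(1) by simp
  have "integral\<^sup>L M (?X (Suc k)) = (\<Sum>i\<in>{1..s}. prob {\<omega> \<in> space M. ip (Suc k) \<omega> = i} *\<^sub>R
          rebk_x_step A b \<alpha> (I i) (integral\<^sup>L M ?Z) (integral\<^sup>L M (?X k)))"
    using step(2) EV by simp
  also have "\<dots> = (\<Sum>i\<in>{1..s}. ((frobenius_norm (row_block A (I i)))\<^sup>2 / (frobenius_norm A)\<^sup>2) *\<^sub>R
          rebk_x_step A b \<alpha> (I i) (integral\<^sup>L M ?Z) (integral\<^sup>L M (?X k)))"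
    using picks by (intro sum.cong) (auto simp: rebk_picks_def)
  also have "\<dots> = integral\<^sup>L M (?X k) - (\<alpha> / (frobenius_norm A)\<^sup>2) *\<^sub>R (transpose A *v
               (A *v integral\<^sup>L M (?X k) - b + integral\<^sup>L M ?Z))"
    by (simp only: rebk_x_step_eq mean_row_block_step[OF I A])
  finally show "integral\<^sup>L M (?X (Suc k)) = integral\<^sup>L M (?X k) - (\<alpha> / (frobenius_norm A)\<^sup>2) *\<^sub>R (transpose A *v
               (A *v integral\<^sup>L M (?X k) - b + integral\<^sup>L M ?Z))" .
qed

text \<open>
  The identity \<open>A\<^sup>T (I - c A A\<^sup>T) = (I - c A\<^sup>T A) A\<^sup>T\<close> moves the averaged column steps from the space of
  \<open>z\<close> to the row space, where they become the same map as the averaged row steps.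
\<close>
lemma transpose_gradient_step_funpow:
  "transpose A *v ((gradient_step (transpose A) c ^^ k) z) = (gradient_step A c ^^ k) (transpose A *v z)"
proof (induction k)
  case (Suc k)
  have "transpose A *v gradient_step (transpose A) c y = gradient_step A c (transpose A *v y)" for y
    by (simp only: gradient_step_def transpose_transpose matrix_vector_mult_diff_distrib
        matrix_vector_mult_scaleR)
  with Suc.IH show ?case by (simp only: funpow.simps comp_def)
qed simp

text \<open>
  With \<open>G = I - c A\<^sup>T A\<close>, \<open>w = A\<^sup>T z\<^sup>0\<close> and \<open>e\<^sub>k\<close> the mean error, the recursion is
  \<open>e\<^sub>k\<^sub>+\<^sub>1 = G e\<^sub>k - c G\<^sup>k\<^sup>+\<^sup>1 w\<close>. Each inhomogeneous term carries one more power of \<open>G\<close>, so after \<open>k\<close> steps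
  the \<open>k\<close> contributions of \<open>z\<^sup>0\<close> are all equal to \<open>c G\<^sup>k w\<close>; this is the source of the factor \<open>k\<close> in the bound.
\<close>
lemma rebk_error_expectation:
  fixes A :: "real^'n^'m" and \<alpha> :: real
  assumes A: "A \<noteq> 0" and I: "block_partition I s" and J: "block_partition J t"
    and picks: "rebk_picks M A I s J t jp ip"
  defines "c \<equiv> \<alpha> / (frobenius_norm A)\<^sup>2"
  shows "integrable M (\<lambda>\<omega>. rebk_x A b \<alpha> I J z0 x0 (\<lambda>l. jp l \<omega>) (\<lambda>l. ip l \<omega>) k) \<and>
         integral\<^sup>L M (\<lambda>\<omega>. rebk_x A b \<alpha> I J z0 x0 (\<lambda>l. jp l \<omega>) (\<lambda>l. ip l \<omega>) k) - pseudoinverse A *v b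
           = (gradient_step A c ^^ k) (x0 - pseudoinverse A *v b)
             - (c * real k) *\<^sub>R (gradient_step A c ^^ k) (transpose A *v z0)"
proof (induction k)
  case 0
  interpret prob_space M
    using picks by (rule rebk_picks_prob_space)
  show ?case by (simp add: prob_space)
next
  case (Suc k)
  let ?X = "\<lambda>k \<omega>. rebk_x A b \<alpha> I J z0 x0 (\<lambda>l. jp l \<omega>) (\<lambda>l. ip l \<omega>) k"
  let ?EX = "\<lambda>k. integral\<^sup>L M (?X k)" and ?EZ = "integral\<^sup>L M (\<lambda>\<omega>. rebk_z A \<alpha> J z0 (\<lambda>l. jp l \<omega>) (Suc k))"
  let ?G = "gradient_step A c" and ?p = "pseudoinverse A *v b" and ?w = "transpose A *v z0"
  note G = linear_diff[OF linear_gradient_step] linear_scale[OF linear_gradient_step]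
  note step = rebk_x_expectation_step[OF A I J picks conjunct1[OF Suc.IH], folded c_def]
  have EZ: "transpose A *v ?EZ = (?G ^^ Suc k) ?w"
    by (simp only: rebk_z_expectation(2)[OF A J picks] c_def transpose_gradient_step_funpow)
  have "?EX (Suc k) - ?p = ?G (?EX k - ?p) - c *\<^sub>R (transpose A *v ?EZ)"
    unfolding step(2) gradient_step_def
    by (simp only: matrix_vector_mult_diff_distrib matrix_vector_right_distrib
        pseudoinverse_normal_equation) (simp add: scaleR_diff_right scaleR_add_right del: transpose_matrix_vector)
  also have "?G (?EX k - ?p) = (?G ^^ Suc k) (x0 - ?p) - (c * real k) *\<^sub>R (?G ^^ Suc k) ?w"
    by (simp only: conjunct2[OF Suc.IH] G funpow.simps comp_def)
  finally have "?EX (Suc k) - ?p = (?G ^^ Suc k) (x0 - ?p) - (c * real (Suc k)) *\<^sub>R (?G ^^ Suc k) ?w"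
    unfolding EZ by (simp add: algebra_simps del: funpow.simps transpose_matrix_vector)
  with step(1) show ?case by blast
qed

section \<open>The convergence bound\<close>
lemma rebk_rate_nonneg:
  assumes "A \<noteq> 0" "\<alpha> > 0"
  shows "rebk_rate A \<alpha> \<ge> 0"
proof -
  have "transpose A \<noteq> 0"
    using assms(1) by (metis frobenius_norm_eq_norm frobenius_norm_transpose norm_eq_zero)
  then obtain y where y: "transpose A *v y \<noteq> 0"
    by (metis matrix_eq matrix_vector_mult_0)
  have "0 \<le> rebk_rate A \<alpha> * norm (transpose A *v y)"
    using norm_gradient_step_le[OF assms, of "transpose A *v y"] norm_ge_zero order_trans
    unfolding col_space_def by blast
  then show ?thesis
    using y by (metis zero_le_mult_iff norm_le_zero_iff)
qed

lemma norm_gradient_step_funpow_le: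
  assumes A: "A \<noteq> 0" "\<alpha> > 0" and v: "v \<in> col_space (transpose A)"
  shows "norm ((gradient_step A (\<alpha> / (frobenius_norm A)\<^sup>2) ^^ k) v) \<le> rebk_rate A \<alpha> ^ k * norm v"
  using v
proof (induction k arbitrary: v)
  case (Suc k)
  let ?G = "gradient_step A (\<alpha> / (frobenius_norm A)\<^sup>2)"
  have "norm ((?G ^^ k) (?G v)) \<le> rebk_rate A \<alpha> ^ k * norm (?G v)"
    by (rule Suc.IH[OF gradient_step_in_row_space[OF Suc.prems]])
  also have "\<dots> \<le> rebk_rate A \<alpha> ^ k * (rebk_rate A \<alpha> * norm v)"
    by (intro mult_left_mono norm_gradient_step_le A Suc.prems zero_le_power rebk_rate_nonneg)
  finally show ?case
    by (simp only: funpow_Suc_right comp_def power_Suc2 mult.assoc)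
qed simp

theorem theorem2:
  fixes A :: "real^'n^'m" and b z0 :: "real^'m" and x0 :: "real^'n"
    and \<alpha> :: real and k s t :: nat
    and I :: "nat \<Rightarrow> 'm set" and J :: "nat \<Rightarrow> 'n set"
    and M :: "'w measure" and jp ip :: "nat \<Rightarrow> 'w \<Rightarrow> nat"
  assumes "A \<noteq> 0"
    and "\<alpha> > 0"
    and "block_partition I s"
    and "block_partition J t"
    and "rebk_picks M A I s J t jp ip"
    and "x0 \<in> col_space (transpose A)"
  shows "norm (integral\<^sup>L M (\<lambda>\<omega>. rebk_x A b \<alpha> I J z0 x0 (\<lambda>l. jp l \<omega>) (\<lambda>l. ip l \<omega>) k
                                  - pseudoinverse A *v b))
       \<le> rebk_rate A \<alpha> ^ k *
           (norm (x0 - pseudoinverse A *v b)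
            + \<alpha> * real k * norm (transpose A *v z0) / (frobenius_norm A)\<^sup>2)"
proof -
  interpret prob_space M
    using assms(5) by (rule rebk_picks_prob_space)
  let ?X = "\<lambda>\<omega>. rebk_x A b \<alpha> I J z0 x0 (\<lambda>l. jp l \<omega>) (\<lambda>l. ip l \<omega>) k"
  let ?p = "pseudoinverse A *v b" and ?w = "transpose A *v z0"
  define c where "c = \<alpha> / (frobenius_norm A)\<^sup>2"
  let ?G = "gradient_step A c ^^ k"
  have c: "c \<ge> 0"
    using assms(2) by (simp add: c_def)
  note X = rebk_error_expectation[OF assms(1,3,4,5), of b \<alpha> z0 x0 k, folded c_def]
  have bound: "norm (?G v) \<le> rebk_rate A \<alpha> ^ k * norm v" if "v \<in> col_space (transpose A)" for v
    using norm_gradient_step_funpow_le[OF assms(1,2) that] by (simp add: c_def)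
  have "integral\<^sup>L M (\<lambda>\<omega>. ?X \<omega> - ?p) = integral\<^sup>L M ?X - ?p"
    using X by (simp add: prob_space del: transpose_matrix_vector)
  also have "\<dots> = ?G (x0 - ?p) - (c * real k) *\<^sub>R ?G ?w"
    using X by blast
  also have "norm \<dots> \<le> norm (?G (x0 - ?p)) + c * real k * norm (?G ?w)"
    using norm_triangle_ineq4[of "?G (x0 - ?p)" "(c * real k) *\<^sub>R ?G ?w"] c
    by (simp only: norm_scaleR) (simp del: transpose_matrix_vector)
  also have "\<dots> \<le> rebk_rate A \<alpha> ^ k * norm (x0 - ?p) + c * real k * (rebk_rate A \<alpha> ^ k * norm ?w)"
  proof (intro add_mono mult_left_mono bound)
    show "x0 - ?p \<in> col_space (transpose A)"
      by (intro subspace_diff subspace_col_space assms(6) pseudoinverse_in_row_space)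
    show "?w \<in> col_space (transpose A)"
      unfolding col_space_def by blast
  qed (use c in simp)
  also have "\<dots> = rebk_rate A \<alpha> ^ k * (norm (x0 - ?p) + \<alpha> * real k * norm ?w / (frobenius_norm A)\<^sup>2)"
    by (simp add: c_def algebra_simps del: transpose_matrix_vector)
  finally show ?thesis .
qed

end
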